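(* The pairing $\omega_{C_{\varphi(T)}}$ on the tangent spaces of $C_{\varphi(T)}$, defined by $\omega_{C_{\varphi(T)}}([(\tau,\xi)],[(\tau',\xi')])=\frac12\mathrm{Tr}(\tau\circ\xi'-\tau'\circ\xi)$, coincides with the Kirillov–Kostant symplectic form $\omega_{\text{K-K}}$ on the adjoint orbit $C_{\varphi(T)}$.
   Context: $V$ is a $\mathbb C$-vector space of dimension $r$, $\varphi(T)\in\mathbb C[T]$ is monic of degree $r$, and $C_{\varphi(T)}$ is the set of $f\in\mathrm{End}(V)$ with minimal polynomial $\varphi(T)$. Put $S(V^\vee,V)=\{\theta\in\mathrm{Hom}(V^\vee,V)\mid{}^t\theta=\theta\}$, $S(V,V^\vee)=\{\kappa\in\mathrm{Hom}(V,V^\vee)\mid{}^t\kappa=\kappa\}$. Every $f\in C_{\varphi(T)}$ can be written $f=\theta\circ\kappa$ with $\theta\in S(V^\vee,V)$ an isomorphism and $\kappa\in S(V,V^\vee)$, uniquely up to the action of $\overline{P(T)}\in(\mathbb C[T]/(\varphi(T)))^\times$ by $(\theta,\kappa)\mapsto(\theta\circ P({}^tf),P({}^tf)^{-1}\circ\kappa)$. Accordingly the tangent space $T_{C_{\varphi(T)}}(f)$ is identified with the cohomology at the middle term, $\ker d^1/\mathrm{im}\,d^0$, of the complex $$\mathbb C[T]/(\varphi(T))\xrightarrow{d^0}S(V^\vee,V)\oplus S(V,V^\vee)\xrightarrow{d^1}(\mathbb C[T]/(\varphi(T)))^\vee,$$ $d^0(\overline{P(T)})=(\theta\circ P({}^tf),-P({}^tf)\circ\kappa)$,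 $d^1(\tau,\xi)(\overline{P(T)})=\mathrm{Tr}(P(f)\circ(\theta\circ\xi+\tau\circ\kappa))$; the class $[(\tau,\xi)]$ corresponds to the tangent vector $\theta\circ\xi+\tau\circ\kappa\in\mathrm{End}(V)$ at $f$. The pairing $\omega_{C_{\varphi(T)}}$ is well defined on these classes. For two classes there exist $g,g'\in\mathrm{End}(V)$ with $f\circ g-g\circ f=\theta\circ\xi+\tau\circ\kappa$ and $f\circ g'-g'\circ f=\theta\circ\xi'+\tau'\circ\kappa$, and the Kirillov–Kostant form is $\omega_{\text{K-K}}([(\tau,\xi)],[(\tau',\xi')])=\mathrm{Tr}(f\circ[g,g'])$ with $[g,g']=g\circ g'-g'\circ g$. *)

theory Defs
  imports Complex_Main "HOL-Computational_Algebra.Polynomial"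
    "HOL-Library.Function_Algebras" "HOL-Library.Product_Plus"
begin

section \<open>Complex vector spaces and their duals\<close>

class complex_vector = ab_group_add +
  fixes scaleC :: "complex \<Rightarrow> 'a \<Rightarrow> 'a" (infixr \<open>*\<^sub>C\<close> 75)
  assumes scaleC_add_right: "a *\<^sub>C (x + y) = a *\<^sub>C x + a *\<^sub>C y"
    and scaleC_add_left: "(a + b) *\<^sub>C x = a *\<^sub>C x + b *\<^sub>C x"
    and scaleC_scaleC: "a *\<^sub>C b *\<^sub>C x = (a * b) *\<^sub>C x"
    and scaleC_one: "1 *\<^sub>C x = x"

global_interpretation complex_vector:
  vector_space "scaleC :: complex \<Rightarrow> 'a \<Rightarrow> 'a::complex_vector"
  by unfold_locales (simp_all add: scaleC_add_right scaleC_add_left scaleC_scaleC scaleC_one)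

abbreviation clinear :: "('a::complex_vector \<Rightarrow> 'b::complex_vector) \<Rightarrow> bool"
  where "clinear \<equiv> Vector_Spaces.linear scaleC scaleC"

lemma clinear_iff:
  "clinear f \<longleftrightarrow> (\<forall>x y. f (x + y) = f x + f y) \<and> (\<forall>a x. f (a *\<^sub>C x) = a *\<^sub>C f x)"
  by (simp add: Vector_Spaces.linear_def module_hom_def module_hom_axioms_def
      complex_vector.vector_space_axioms complex_vector.module_axioms)

instantiation complex :: complex_vector
begin
definition scaleC_complex :: "complex \<Rightarrow> complex \<Rightarrow> complex"
  where "scaleC_complex a x = a * x"
instance by standard (simp_all add: scaleC_complex_def algebra_simps)
end

text \<open>With finite \<open>'i\<close>, the type \<open>'i \<Rightarrow> complex\<close> is a coordinate space.\<close>

instantiation "fun" :: (type, complex_vector) complex_vector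
begin
definition scaleC_fun :: "complex \<Rightarrow> ('a \<Rightarrow> 'b) \<Rightarrow> 'a \<Rightarrow> 'b"
  where "scaleC_fun a f = (\<lambda>x. a *\<^sub>C f x)"
instance
  by standard
    (simp_all add: scaleC_fun_def fun_eq_iff scaleC_add_right scaleC_add_left scaleC_scaleC scaleC_one)
end

typedef (overloaded) 'v dual = "{\<alpha> :: 'v::complex_vector \<Rightarrow> complex. clinear \<alpha>}"
  morphisms dual_apply Abs_dual
  by (rule exI[of _ "\<lambda>_. 0"]) (simp add: clinear_iff scaleC_complex_def)

setup_lifting type_definition_dual

instantiation dual :: (complex_vector) complex_vector
begin
lift_definition zero_dual :: "'a dual" is "\<lambda>_. 0"
  by (simp add: clinear_iff scaleC_complex_def)
lift_definition plus_dual :: "'a dual \<Rightarrow> 'a dual \<Rightarrow> 'a dual" is "\<lambda>\<alpha> \<beta> v. \<alpha> v + \<beta> v"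
  by (simp add: clinear_iff scaleC_complex_def algebra_simps)
lift_definition minus_dual :: "'a dual \<Rightarrow> 'a dual \<Rightarrow> 'a dual" is "\<lambda>\<alpha> \<beta> v. \<alpha> v - \<beta> v"
  by (simp add: clinear_iff scaleC_complex_def algebra_simps)
lift_definition uminus_dual :: "'a dual \<Rightarrow> 'a dual" is "\<lambda>\<alpha> v. - \<alpha> v"
  by (simp add: clinear_iff scaleC_complex_def)
lift_definition scaleC_dual :: "complex \<Rightarrow> 'a dual \<Rightarrow> 'a dual" is "\<lambda>a \<alpha> v. a * \<alpha> v"
  by (simp add: clinear_iff scaleC_complex_def algebra_simps)
instance
  by standard (transfer, simp add: fun_eq_iff algebra_simps)+
end

lift_definition eval_dual :: "'v::complex_vector \<Rightarrow> 'v dual dual" is "\<lambda>v \<alpha>. dual_apply \<alpha> v"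
  by (simp add: clinear_iff plus_dual.rep_eq scaleC_dual.rep_eq scaleC_complex_def)

text \<open>Only meaningful for linear \<open>h\<close>.\<close>

definition transpose_map ::
    "('v::complex_vector \<Rightarrow> 'w::complex_vector) \<Rightarrow> 'w dual \<Rightarrow> 'v dual"
  where "transpose_map h \<alpha> = Abs_dual (dual_apply \<alpha> \<circ> h)"

lemma dual_apply_transpose_map:
  "clinear h \<Longrightarrow> dual_apply (transpose_map h \<alpha>) v = dual_apply \<alpha> (h v)"
  using dual_apply[of \<alpha>]
  by (simp add: transpose_map_def Abs_dual_inverse clinear_iff)

text \<open>The transpose of a map \<open>V\<^sup>\<or> \<rightarrow> V\<close> has values in the double dual, and the transpose of a
  map \<open>V \<rightarrow> V\<^sup>\<or>\<close> is defined on it; \<open>eval_dual\<close> is the identification of \<open>V\<close> with its double dual.\<close>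

definition sym_from_dual :: "('v::complex_vector dual \<Rightarrow> 'v) set"
  where "sym_from_dual = {\<theta>. clinear \<theta> \<and> transpose_map \<theta> = eval_dual \<circ> \<theta>}"

definition sym_to_dual :: "('v::complex_vector \<Rightarrow> 'v dual) set"
  where "sym_to_dual = {\<kappa>. clinear \<kappa> \<and> transpose_map \<kappa> \<circ> eval_dual = \<kappa>}"

section \<open>Endomorphisms with given minimal polynomial\<close>

definition trace :: "('v::complex_vector \<Rightarrow> 'v) \<Rightarrow> complex"
  where "trace h =
    (let B = (SOME B :: 'v set. complex_vector.independent B \<and> complex_vector.span B = UNIV)
     in \<Sum>b\<in>B. complex_vector.representation B (h b) b)"

definition poly_map :: "complex poly \<Rightarrow> ('v::complex_vector \<Rightarrow> 'v) \<Rightarrow> 'v \<Rightarrow> 'v"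
  where "poly_map P h = (\<lambda>v. \<Sum>i\<le>degree P. coeff P i *\<^sub>C (h ^^ i) v)"

definition is_minimal_poly :: "('v::complex_vector \<Rightarrow> 'v) \<Rightarrow> complex poly \<Rightarrow> bool"
  where "is_minimal_poly f \<phi> \<longleftrightarrow>
    lead_coeff \<phi> = 1 \<and> poly_map \<phi> f = 0 \<and>
    (\<forall>P. P \<noteq> 0 \<longrightarrow> poly_map P f = 0 \<longrightarrow> degree \<phi> \<le> degree P)"

definition endos_with_minpoly :: "complex poly \<Rightarrow> ('v::complex_vector \<Rightarrow> 'v) set"
  where "endos_with_minpoly \<phi> = {f. clinear f \<and> is_minimal_poly f \<phi>}"

definition commutator :: "('v::complex_vector \<Rightarrow> 'v) \<Rightarrow> ('v \<Rightarrow> 'v) \<Rightarrow> 'v \<Rightarrow> 'v"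
  where "commutator g h = (g \<circ> h) - (h \<circ> g)"

section \<open>The tangent complex\<close>

text \<open>Both differentials are written on representatives \<open>P\<close> of classes in \<open>\<complex>[T]/(\<phi>)\<close>. As
  \<open>\<phi>(f) = 0\<close>, they depend only on the class of \<open>P\<close>, so the image of \<open>d0\<close> and the kernel of \<open>d1\<close>
  are those of the complex starting at \<open>\<complex>[T]/(\<phi>)\<close> and ending at its dual.\<close>

definition d0 ::
    "('v::complex_vector \<Rightarrow> 'v) \<Rightarrow> ('v dual \<Rightarrow> 'v) \<Rightarrow> ('v \<Rightarrow> 'v dual) \<Rightarrow>
     complex poly \<Rightarrow> ('v dual \<Rightarrow> 'v) \<times> ('v \<Rightarrow> 'v dual)"
  where "d0 f \<theta> \<kappa> P =
    (\<theta> \<circ> poly_map P (transpose_map f), - (poly_map P (transpose_map f) \<circ> \<kappa>))"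

definition d1 ::
    "('v::complex_vector \<Rightarrow> 'v) \<Rightarrow> ('v dual \<Rightarrow> 'v) \<Rightarrow> ('v \<Rightarrow> 'v dual) \<Rightarrow>
     ('v dual \<Rightarrow> 'v) \<times> ('v \<Rightarrow> 'v dual) \<Rightarrow> complex poly \<Rightarrow> complex"
  where "d1 f \<theta> \<kappa> = (\<lambda>(\<tau>, \<xi>) P. trace (poly_map P f \<circ> ((\<theta> \<circ> \<xi>) + (\<tau> \<circ> \<kappa>))))"

definition d1_kernel ::
    "('v::complex_vector \<Rightarrow> 'v) \<Rightarrow> ('v dual \<Rightarrow> 'v) \<Rightarrow> ('v \<Rightarrow> 'v dual) \<Rightarrow>
     (('v dual \<Rightarrow> 'v) \<times> ('v \<Rightarrow> 'v dual)) set"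
  where "d1_kernel f \<theta> \<kappa> = {x \<in> sym_from_dual \<times> sym_to_dual. d1 f \<theta> \<kappa> x = 0}"

definition tangent_space ::
    "('v::complex_vector \<Rightarrow> 'v) \<Rightarrow> ('v dual \<Rightarrow> 'v) \<Rightarrow> ('v \<Rightarrow> 'v dual) \<Rightarrow>
     (('v dual \<Rightarrow> 'v) \<times> ('v \<Rightarrow> 'v dual)) set set"
  where "tangent_space f \<theta> \<kappa> =
    d1_kernel f \<theta> \<kappa> //
      {(x, y). x \<in> d1_kernel f \<theta> \<kappa> \<and> y \<in> d1_kernel f \<theta> \<kappa> \<and> x - y \<in> range (d0 f \<theta> \<kappa>)}"

section \<open>The two pairings\<close>

definition omega_C ::
    "(('v::complex_vector dual \<Rightarrow> 'v) \<times> ('v \<Rightarrow> 'v dual)) set \<Rightarrow>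
     (('v dual \<Rightarrow> 'v) \<times> ('v \<Rightarrow> 'v dual)) set \<Rightarrow> complex"
  where "omega_C X X' =
    (THE z. \<exists>(\<tau>, \<xi>)\<in>X. \<exists>(\<tau>', \<xi>')\<in>X'. z = 1/2 * trace ((\<tau> \<circ> \<xi>') - (\<tau>' \<circ> \<xi>)))"

definition omega_KK ::
    "('v::complex_vector \<Rightarrow> 'v) \<Rightarrow> ('v dual \<Rightarrow> 'v) \<Rightarrow> ('v \<Rightarrow> 'v dual) \<Rightarrow>
     (('v dual \<Rightarrow> 'v) \<times> ('v \<Rightarrow> 'v dual)) set \<Rightarrow>
     (('v dual \<Rightarrow> 'v) \<times> ('v \<Rightarrow> 'v dual)) set \<Rightarrow> complex"
  where "omega_KK f \<theta> \<kappa> X X' =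
    (THE z. \<exists>(\<tau>, \<xi>)\<in>X. \<exists>(\<tau>', \<xi>')\<in>X'. \<exists>g g'. clinear g \<and> clinear g' \<and>
       commutator f g = (\<theta> \<circ> \<xi>) + (\<tau> \<circ> \<kappa>) \<and> commutator f g' = (\<theta> \<circ> \<xi>') + (\<tau>' \<circ> \<kappa>) \<and>
       z = trace (f \<circ> commutator g g'))"

end

theory Submission
  imports Defs "HOL-Computational_Algebra.Fundamental_Theorem_Algebra"
begin

text \<open>The form \<open>\<eta>(u, w) = \<langle>\<theta>\<^sup>-\<^sup>1 u, w\<rangle>\<close> on \<open>V\<close> is symmetric and nondegenerate, and \<open>f\<close>,
  \<open>s = \<tau> \<circ> \<theta>\<^sup>-\<^sup>1\<close> and \<open>x = \<theta> \<circ> \<xi>\<close> are self-adjoint for it; the tangent vector is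
  \<open>A = x + s f = [f, g]\<close>. Comparing \<open>A'\<close> with its adjoint, \<open>g' + g'\<^sup>* + s'\<close> commutes with \<open>f\<close>.
  Since \<open>f\<close> has a cyclic vector, its commutant consists of the polynomials in \<open>f\<close>, which are
  trace-orthogonal to \<open>A\<close>. Hence \<open>Tr(f[g, g']) = Tr(A g') = Tr(g'\<^sup>* A\<^sup>*)\<close>, and replacing \<open>g'\<^sup>*\<close>
  by \<open>- g' - s'\<close> and averaging the two expressions gives \<open>(Tr(s x') - Tr(s' x)) / 2\<close>. Elements of
  \<open>im d\<^sup>0\<close> do not change \<open>A\<close>, so both pairings are well defined on classes.\<close>

section \<open>Elementary rules for complex-linear maps\<close>

lemma clinear_comp:
  "clinear f \<Longrightarrow> clinear g \<Longrightarrow> clinear (f \<circ> g)"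
  by (simp add: clinear_iff)

lemma clinear_plus:
  "clinear f \<Longrightarrow> clinear g \<Longrightarrow> clinear (f + g)"
  by (simp add: clinear_iff scaleC_add_right algebra_simps)

lemma clinear_minus:
  "clinear f \<Longrightarrow> clinear g \<Longrightarrow> clinear (f - g)"
  by (simp add: clinear_iff complex_vector.scale_right_diff_distrib)

lemma clinear_commutator: "clinear g \<Longrightarrow> clinear h \<Longrightarrow> clinear (commutator g h)"
  by (simp add: commutator_def clinear_comp clinear_minus)

lemma clinear_zero: "clinear f \<Longrightarrow> f 0 = 0"
  by (metis clinear_iff add_cancel_right_right)

lemma clinear_neg: "clinear f \<Longrightarrow> f (- x) = - f x"
  by (metis clinear_iff clinear_zero eq_neg_iff_add_eq_0 add.left_inverse)

lemma clinear_diff: "clinear f \<Longrightarrow> f (x - y) = f x - f y"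
  by (metis clinear_iff clinear_neg diff_conv_add_uminus)

lemma clinear_sum: "clinear f \<Longrightarrow> f (sum g A) = (\<Sum>a\<in>A. f (g a))"
  by (induction A rule: infinite_finite_induct) (simp_all add: clinear_zero clinear_iff)

lemma clinear_complexI:
  "(\<And>x y. f (x + y) = f x + f y) \<Longrightarrow> (\<And>a x. f (a *\<^sub>C x) = a * f x) \<Longrightarrow> clinear f"
  for f :: "'a::complex_vector \<Rightarrow> complex"
  by (simp add: clinear_iff scaleC_complex_def)

lemma clinear_complex_scale: "clinear f \<Longrightarrow> f (a *\<^sub>C x) = a * f x"
  for f :: "'a::complex_vector \<Rightarrow> complex"
  by (simp add: clinear_iff scaleC_complex_def)

lemma clinear_add: "clinear f \<Longrightarrow> f (x + y) = f x + f y"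
  by (simp add: clinear_iff)

lemma clinear_scale: "clinear f \<Longrightarrow> f (a *\<^sub>C x) = a *\<^sub>C f x"
  by (simp add: clinear_iff)

lemma clinear_rank_one:
  "clinear \<alpha> \<Longrightarrow> clinear (\<lambda>w. \<alpha> w *\<^sub>C u)" for \<alpha> :: "'a::complex_vector \<Rightarrow> complex"
  by (simp add: clinear_iff scaleC_add_left scaleC_scaleC scaleC_complex_def)

section \<open>Separating and avoiding subspaces\<close>

text \<open>A basis of \<open>S\<close> together with \<open>a\<close> is independent, so the values
  0 on the basis and 1 at \<open>a\<close> extend to a linear functional. It is applied in the space
  of all functions from V to V, with the image of \<open>commutator f\<close> as
  \<open>S\<close>.\<close>

lemma subspace_separation:
  fixes S :: "'a::complex_vector set"
  assumes "complex_vector.subspace S" "a \<notin> S"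
  obtains l :: "'a \<Rightarrow> complex" where "clinear l" "\<And>x. x \<in> S \<Longrightarrow> l x = 0" "l a = 1"
proof -
  interpret vector_space_pair "scaleC :: complex \<Rightarrow> 'a \<Rightarrow> 'a" "scaleC :: complex \<Rightarrow> complex \<Rightarrow> complex"
    by unfold_locales
  obtain C where C: "complex_vector.independent C" "C \<subseteq> S" "S \<subseteq> complex_vector.span C"
    using complex_vector.maximal_independent_subset by blast
  have SC: "complex_vector.span C = S"
    using C assms(1) complex_vector.span_minimal by blast
  have ind: "complex_vector.independent (insert a C)"
    using C(1) SC assms(2) by (simp add: complex_vector.independent_insertI)
  from linear_independent_extend[OF ind, of "\<lambda>x. if x = a then 1 else 0"]
  obtain l :: "'a \<Rightarrow> complex" where
    l: "clinear l" "\<And>x. x \<in> insert a C \<Longrightarrow> l x = (if x = a then 1 else 0)" by blast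
  show thesis
  proof
    show "clinear l" by fact
    show "l a = 1" using l(2) by simp
    fix x assume "x \<in> S"
    moreover have "\<And>x. x \<in> C \<Longrightarrow> l x = 0" using l(2) C(2) assms(2) by auto
    ultimately show "l x = 0" using SC l(1) linear_eq_0_on_span by blast
  qed
qed

text \<open>Induction on the family: let \<open>v\<close> avoid the earlier members. If
  \<open>v\<close> lies in the new subspace \<open>S\<close>, move from a point \<open>w\<close>
  outside \<open>S\<close> along the line \<open>w + c *\<^sub>C v\<close>. It never meets
  \<open>S\<close>, and it meets each earlier \<open>T\<close> for at most one \<open>c\<close>,
  because two such values would put \<open>v\<close> into \<open>T\<close>. As the complex numbers
  are infinite, some \<open>c\<close> avoids everything.\<close>

lemma subspace_finite_union:
  fixes F :: "'a::complex_vector set set"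
  assumes "finite F" "\<And>S. S \<in> F \<Longrightarrow> complex_vector.subspace S \<and> S \<noteq> UNIV"
  shows "\<exists>v. \<forall>S\<in>F. v \<notin> S"
  using assms
proof (induction F rule: finite_induct)
  case empty
  then show ?case by simp
next
  case (insert S F)
  then obtain v where v: "\<And>T. T \<in> F \<Longrightarrow> v \<notin> T" by auto
  show ?case
  proof (cases "v \<in> S")
    case False
    then show ?thesis using v by auto
  next
    case True
    obtain w where w: "w \<notin> S" using insert.prems by blast
    have at_most_one: "finite {c. w + c *\<^sub>C v \<in> T}" if T: "T \<in> F" for T
    proof -
      have sub: "complex_vector.subspace T" using insert.prems T by blast
      have "c = c'" if c: "w + c *\<^sub>C v \<in> T" "w + c' *\<^sub>C v \<in> T" for c c'
      proof (rule ccontr)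
        assume ne: "c \<noteq> c'"
        have "(c - c') *\<^sub>C v \<in> T"
          using complex_vector.subspace_diff[OF sub c]
          by (simp add: complex_vector.scale_left_diff_distrib)
        then have "(1 / (c - c')) *\<^sub>C (c - c') *\<^sub>C v \<in> T"
          by (rule complex_vector.subspace_scale[OF sub])
        then show False using v[OF T] ne by (simp add: scaleC_scaleC scaleC_one)
      qed
      then have "{c. w + c *\<^sub>C v \<in> T} \<subseteq> {c}" if "w + c *\<^sub>C v \<in> T" for c
        using that by blast
      then show ?thesis
        by (metis (mono_tags, lifting) finite.simps finite_subset Collect_empty_eq)
    qed
    then have "finite (\<Union>T\<in>F. {c. w + c *\<^sub>C v \<in> T})" using insert.hyps by blast
    then obtain c where c: "\<And>T. T \<in> F \<Longrightarrow> w + c *\<^sub>C v \<notin> T"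
      using ex_new_if_finite[OF infinite_UNIV_char_0[where 'a=complex]] by blast
    have "w + c *\<^sub>C v \<notin> S"
    proof
      have S: "complex_vector.subspace S" using insert.prems by blast
      assume "w + c *\<^sub>C v \<in> S"
      from complex_vector.subspace_diff[OF S this complex_vector.subspace_scale[OF S True]]
      show False using w by (metis add_diff_cancel_right')
    qed
    then show ?thesis using c by blast
  qed
qed

section \<open>Polynomials in an endomorphism\<close>

lemma poly_map_eq_sum:
  assumes "degree P < n"
  shows "poly_map P h v = (\<Sum>i<n. coeff P i *\<^sub>C (h ^^ i) v)"
  unfolding poly_map_def
  by (rule sum.mono_neutral_left) (use assms in \<open>auto simp: coeff_eq_0\<close>)

lemma poly_map_0 [simp]: "poly_map 0 h v = 0"
  by (simp add: poly_map_def)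

lemma poly_map_pCons:
  assumes "clinear h"
  shows "poly_map (pCons a P) h v = a *\<^sub>C v + h (poly_map P h v)"
proof -
  have "poly_map (pCons a P) h v = (\<Sum>i<Suc (Suc (degree P)). coeff (pCons a P) i *\<^sub>C (h ^^ i) v)"
    by (rule poly_map_eq_sum) (meson degree_pCons_le le_imp_less_Suc)
  also have "\<dots> = a *\<^sub>C v + (\<Sum>i<Suc (degree P). coeff P i *\<^sub>C (h ^^ Suc i) v)"
    by (subst sum.lessThan_Suc_shift) simp
  also have "\<dots> = a *\<^sub>C v + h (poly_map P h v)"
    using assms by (simp add: poly_map_eq_sum[of _ "Suc (degree P)"] clinear_sum clinear_scale clinear_add)
  finally show ?thesis .
qed

lemma clinear_poly_map: "clinear h \<Longrightarrow> clinear (poly_map P h)"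
  by (induction P)
     (simp_all add: clinear_iff poly_map_pCons scaleC_add_right scaleC_scaleC mult.commute algebra_simps)

lemma poly_map_add:
  assumes "clinear h"
  shows "poly_map (P + Q) h v = poly_map P h v + poly_map Q h v"
proof (induction P Q rule: poly_induct2)
  case (pCons a P b Q)
  then show ?case using assms
    by (simp add: poly_map_pCons clinear_add scaleC_add_left algebra_simps)
qed simp

lemma poly_map_smult:
  "clinear h \<Longrightarrow> poly_map (smult a P) h v = a *\<^sub>C poly_map P h v"
  by (induction P) (simp_all add: poly_map_pCons clinear_scale scaleC_add_right scaleC_scaleC)

lemma poly_map_mult:
  assumes "clinear h"
  shows "poly_map (P * Q) h v = poly_map P h (poly_map Q h v)"
  using assms by (induction P) (simp_all add: poly_map_pCons poly_map_add poly_map_smult)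

lemma poly_map_intertwine:
  assumes "clinear h" "clinear k" "clinear g" "\<And>v. g (h v) = k (g v)"
  shows "g (poly_map P h v) = poly_map P k (g v)"
  using assms by (induction P) (simp_all add: poly_map_pCons clinear_zero clinear_add clinear_scale)

text \<open>A vector outside the finitely many proper subspaces \<open>ker (\<phi>/(T - \<lambda>))(f)\<close>, for \<open>\<lambda>\<close> a root
  of \<open>\<phi>\<close>, has annihilator \<open>\<phi>\<close>.\<close>

lemma minimal_poly_attained:
  fixes f :: "'v::complex_vector \<Rightarrow> 'v"
  assumes f: "clinear f" and min: "is_minimal_poly f \<phi>"
  obtains v where "\<And>P. P \<noteq> 0 \<Longrightarrow> poly_map P f v = 0 \<Longrightarrow> degree \<phi> \<le> degree P"
proof -
  have \<phi>: "\<phi> \<noteq> 0" "poly_map \<phi> f = 0" using min by (auto simp: is_minimal_poly_def)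
  define K where "K z = {v. poly_map (\<phi> div [:- z, 1:]) f v = 0}" for z
  have fin: "finite (K ` {z. poly \<phi> z = 0})"
    using \<phi>(1) poly_roots_finite by blast
  have proper: "complex_vector.subspace (K z) \<and> K z \<noteq> UNIV" if z: "poly \<phi> z = 0" for z
  proof
    show "complex_vector.subspace (K z)"
      using clinear_poly_map[OF f, of "\<phi> div [:- z, 1:]"]
      by (simp add: K_def complex_vector.subspace_def clinear_zero clinear_add clinear_scale)
    show "K z \<noteq> UNIV"
    proof
      assume "K z = UNIV"
      then have 0: "poly_map (\<phi> div [:- z, 1:]) f = 0" by (auto simp: K_def fun_eq_iff)
      have eq: "\<phi> = [:- z, 1:] * (\<phi> div [:- z, 1:])" using z by (metis dvd_mult_div_cancel poly_eq_0_iff_dvd)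
      then have ne: "\<phi> div [:- z, 1:] \<noteq> 0" using \<phi>(1) by (metis mult_zero_right)
      then have "degree \<phi> = Suc (degree (\<phi> div [:- z, 1:]))"
        by (subst eq, subst degree_mult_eq) auto
      then show False using min 0 ne by (auto simp: is_minimal_poly_def)
    qed
  qed
  have "\<exists>v. \<forall>S\<in>K ` {z. poly \<phi> z = 0}. v \<notin> S"
    using proper by (intro subspace_finite_union fin) auto
  then obtain v where v: "\<And>z. poly \<phi> z = 0 \<Longrightarrow> v \<notin> K z" by auto
  have main: "degree \<phi> \<le> degree P" if P: "P \<noteq> 0" "poly_map P f v = 0" for P
  proof -
    \<comment> \<open>\<open>Q\<close> is an annihilator of \<open>v\<close> of least degree.
      Division with remainder shows that it divides \<phi>. The cofactor \<open>h\<close> is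
      constant, since a root \<open>z\<close> of \<open>h\<close> would make \<open>Q\<close> a
      divisor of \<phi>/(T - z) and so put \<open>v\<close> into \<open>K z\<close>.\<close>
    define Q where "Q = arg_min degree (\<lambda>Q. Q \<noteq> 0 \<and> poly_map Q f v = 0)"
    have Q: "Q \<noteq> 0" "poly_map Q f v = 0"
      and Qmin: "\<And>R. R \<noteq> 0 \<Longrightarrow> poly_map R f v = 0 \<Longrightarrow> degree Q \<le> degree R"
      using arg_min_natI[of "\<lambda>Q. Q \<noteq> 0 \<and> poly_map Q f v = 0" P degree]
        arg_min_nat_le[of "\<lambda>Q. Q \<noteq> 0 \<and> poly_map Q f v = 0" _ degree] P
      unfolding Q_def by auto
    have "poly_map (\<phi> div Q * Q + \<phi> mod Q) f v = 0" using \<phi>(2) by simp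
    then have "poly_map (\<phi> mod Q) f v = 0"
      unfolding poly_map_add[OF f] poly_map_mult[OF f] Q(2)
      by (simp add: clinear_zero clinear_poly_map f)
    then have mod0: "\<phi> mod Q = 0"
      using Qmin degree_mod_less[OF Q(1), of \<phi>] by fastforce
    define h where "h = \<phi> div Q"
    have \<phi>h: "\<phi> = h * Q" using mod0 div_mult_mod_eq[of \<phi> Q] by (simp add: h_def)
    have "degree h = 0"
    proof (rule ccontr)
      assume "degree h \<noteq> 0"
      then have "\<not> constant (poly h)" by (simp add: constant_degree)
      then obtain z where z: "poly h z = 0" using fundamental_theorem_of_algebra by blast
      then obtain k where k: "h = [:- z, 1:] * k" by (metis poly_eq_0_iff_dvd dvdE)
      have "\<phi> = [:- z, 1:] * (k * Q)" by (simp only: \<phi>h k mult.assoc)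
      then have "\<phi> div [:- z, 1:] = k * Q"
        by (metis nonzero_mult_div_cancel_left pCons_eq_0_iff one_neq_zero)
      then have "v \<in> K z"
        by (simp add: K_def poly_map_mult f Q(2) clinear_zero clinear_poly_map)
      moreover have "poly \<phi> z = 0" using z \<phi>h by simp
      ultimately show False using v by blast
    qed
    then have "degree \<phi> \<le> degree Q" using degree_mult_le[of h Q] \<phi>h by simp
    then show ?thesis using Qmin P by fastforce
  qed
  show thesis by (rule that) (rule main)
qed

section \<open>Cyclic vectors and the centralizer\<close>

locale finite_dim_complex =
  finite_dimensional_vector_space "scaleC :: complex \<Rightarrow> 'v \<Rightarrow> 'v::complex_vector" Basis for Basis
begin

text \<open>Choose \<open>v\<close> annihilated by no nonzero polynomial of degree below that of
  \<phi>. Then the iterates \<open>(f ^^ i) v\<close> with \<open>i < degree \<phi>\<close> are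
  independent, and their number is the dimension, so they span.\<close>

lemma cyclic_vector:
  fixes f :: "'v \<Rightarrow> 'v"
  assumes f: "clinear f" and min: "is_minimal_poly f \<phi>" and deg: "degree \<phi> = dim (UNIV :: 'v set)"
  obtains v where "\<And>w. \<exists>P. w = poly_map P f v"
proof -
  obtain v where v: "\<And>P. P \<noteq> 0 \<Longrightarrow> poly_map P f v = 0 \<Longrightarrow> degree \<phi> \<le> degree P"
    using minimal_poly_attained[OF f min] by blast
  define n where "n = degree \<phi>"
  define e where "e i = (f ^^ i) v" for i
  have zero: "P = 0" if "poly_map P f v = 0" "degree P < n" for P
    using v that by (force simp: n_def)
  \<comment> \<open>The degree bound is guarded by \<open>n > 0\<close> because the zero polynomial
    has degree 0. For \<open>n = 0\<close> both sums are empty.\<close>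
  have sum_poly: "(\<Sum>i<n. c i *\<^sub>C e i) = poly_map (\<Sum>i<n. monom (c i) i) f v \<and>
      (\<forall>i<n. coeff (\<Sum>i<n. monom (c i) i) i = c i) \<and>
      (n > 0 \<longrightarrow> degree (\<Sum>i<n. monom (c i) i) < n)" for c
  proof (cases "n = 0")
    case False
    have co: "\<forall>i<n. coeff (\<Sum>i<n. monom (c i) i) i = c i" by (simp add: coeff_sum)
    have d: "degree (\<Sum>i<n. monom (c i) i) < n"
      using False
      by (intro degree_sum_less) (auto intro: le_less_trans[OF degree_monom_le])
    show ?thesis using co d by (simp add: poly_map_eq_sum[OF d] e_def)
  qed simp
  have indep_fam: "c i = 0" if "(\<Sum>i<n. c i *\<^sub>C e i) = 0" "i < n" for c i
    using sum_poly[of c] zero that by fastforce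
  have inj: "inj_on e {..<n}"
  proof (rule inj_onI, rule ccontr)
    fix i j assume ij: "i \<in> {..<n}" "j \<in> {..<n}" "e i = e j" "i \<noteq> j"
    \<comment> \<open>These are the coefficients of the relation \<open>e i - e j = 0\<close>.
      Injectivity is what turns independence of the family into independence of its image set, with
      the right cardinality.\<close>
    define c where "c k = (if k = i then 1 else if k = j then -1 else 0 :: complex)" for k
    have "(\<Sum>k<n. c k *\<^sub>C e k) = (\<Sum>k\<in>{i, j}. c k *\<^sub>C e k)"
      using ij by (intro sum.mono_neutral_right) (auto simp: c_def)
    also have "\<dots> = 0" using ij by (simp add: c_def)
    finally show False using indep_fam[of c i] ij by (simp add: c_def)
  qed
  have "independent (e ` {..<n})"
  proof (rule independent_if_scalars_zero)
    fix c x assume "(\<Sum>x\<in>e ` {..<n}. c x *\<^sub>C x) = 0" and x: "x \<in> e ` {..<n}"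
    then have "(\<Sum>i<n. c (e i) *\<^sub>C e i) = 0" by (simp add: sum.reindex[OF inj])
    then show "c x = 0" using indep_fam[of "\<lambda>i. c (e i)"] x by auto
  qed simp
  moreover have "card (e ` {..<n}) = dim (UNIV :: 'v set)"
    using card_image[OF inj] deg by (simp add: n_def)
  ultimately have span: "UNIV \<subseteq> span (e ` {..<n})"
    using card_ge_dim_independent[of "e ` {..<n}" UNIV] by simp
  show thesis
  proof
    fix w
    have "w \<in> span (e ` {..<n})" using span by blast
    then obtain u where "w = (\<Sum>x\<in>e ` {..<n}. u x *\<^sub>C x)"
      using span_finite[of "e ` {..<n}"] by auto
    then have "w = (\<Sum>i<n. u (e i) *\<^sub>C e i)" by (simp add: sum.reindex[OF inj])
    then have "w = poly_map (\<Sum>i<n. monom (u (e i)) i) f v"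
      by (rule trans[OF _ conjunct1[OF sum_poly]])
    then show "\<exists>P. w = poly_map P f v" by blast
  qed
qed

text \<open>A map commuting with \<open>f\<close> is determined by its value at a cyclic vector
  \<open>v\<close>. Writing that value as \<open>poly_map P f v\<close> makes \<open>h\<close> agree
  with \<open>poly_map P f\<close> at \<open>v\<close>, hence everywhere.\<close>

lemma centralizer_poly_map:
  fixes f :: "'v \<Rightarrow> 'v"
  assumes f: "clinear f" and min: "is_minimal_poly f \<phi>" and deg: "degree \<phi> = dim (UNIV :: 'v set)"
    and h: "clinear h" "h \<circ> f = f \<circ> h"
  shows "\<exists>P. h = poly_map P f"
proof -
  obtain v where v: "\<And>w. \<exists>P. w = poly_map P f v" using cyclic_vector[OF f min deg] by blast
  obtain P where P: "h v = poly_map P f v" using v by blast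
  have "h w = poly_map P f w" for w
  proof -
    obtain Q where w: "w = poly_map Q f v" using v by blast
    have "h w = poly_map Q f (h v)"
      unfolding w using h(2) by (intro poly_map_intertwine f h(1)) (simp add: fun_eq_iff)
    also have "\<dots> = poly_map P f w"
      unfolding P w by (metis poly_map_mult[OF f] mult.commute)
    finally show ?thesis .
  qed
  then show ?thesis by blast
qed

section \<open>The trace and the trace form\<close>

text \<open>The \<open>Basis\<close> of the locale shows that the choice inside \<open>trace\<close>
  does pick a basis. All later facts on traces rest on these three properties of its coordinate
  functionals \<open>\<beta> b\<close>.\<close>

lemma trace_basis:
  obtains T :: "'v set" and \<beta> :: "'v \<Rightarrow> 'v \<Rightarrow> complex" where
    "\<And>b. clinear (\<beta> b)" "\<And>v. (\<Sum>b\<in>T. \<beta> b v *\<^sub>C b) = v"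
    "\<And>h :: 'v \<Rightarrow> 'v. trace h = (\<Sum>b\<in>T. \<beta> b (h b))"
proof -
  define T where "T = (SOME B :: 'v set. independent B \<and> span B = UNIV)"
  have T: "independent T \<and> span T = UNIV"
    unfolding T_def by (rule someI[of _ Basis]) (simp add: independent_Basis span_Basis)
  define \<beta> where "\<beta> b v = representation T v b" for b v
  have "clinear (\<beta> b)" for b
    using T by (intro clinear_complexI) (simp_all add: \<beta>_def representation_add representation_scale)
  moreover have "(\<Sum>b\<in>T. \<beta> b v *\<^sub>C b) = v" for v
    unfolding \<beta>_def using T by (intro sum_representation_eq) (auto intro: finiteI_independent)
  moreover have "trace h = (\<Sum>b\<in>T. \<beta> b (h b))" for h :: "'v \<Rightarrow> 'v"
    by (simp add: trace_def Let_def T_def \<beta>_def)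
  ultimately show thesis by (rule that)
qed

lemma trace_add: "trace (g + h) = trace g + trace h" for g h :: "'v \<Rightarrow> 'v"
proof -
  obtain T \<beta> where "\<And>b. clinear (\<beta> b)" "\<And>h :: 'v \<Rightarrow> 'v. trace h = (\<Sum>b\<in>T. \<beta> b (h b))"
    using trace_basis by metis
  then show ?thesis by (simp add: clinear_add sum.distrib)
qed

lemma trace_diff: "trace (g - h) = trace g - trace h" for g h :: "'v \<Rightarrow> 'v"
  using trace_add[of "g - h" h] by simp

text \<open>Both sides become the same double sum of products of matrix entries, with the order of
  summation exchanged.\<close>

lemma trace_commute:
  fixes g h :: "'v \<Rightarrow> 'v"
  assumes g: "clinear g" and h: "clinear h"
  shows "trace (g \<circ> h) = trace (h \<circ> g)"
proof -
  obtain T \<beta> where \<beta>: "\<And>b. clinear (\<beta> b)" and ex: "\<And>v. (\<Sum>b\<in>T. \<beta> b v *\<^sub>C b) = v"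
    and tr: "\<And>h :: 'v \<Rightarrow> 'v. trace h = (\<Sum>b\<in>T. \<beta> b (h b))"
    using trace_basis by metis
  have eq: "trace (g \<circ> h) = (\<Sum>b\<in>T. \<Sum>c\<in>T. \<beta> c (h b) * \<beta> b (g c))"
    if g: "clinear g" for g h :: "'v \<Rightarrow> 'v"
  proof -
    have "\<beta> b (g (h b)) = (\<Sum>c\<in>T. \<beta> c (h b) * \<beta> b (g c))" for b
      by (subst ex[of "h b", symmetric])
         (simp only: clinear_sum[OF g] clinear_sum[OF \<beta>] clinear_scale[OF g] clinear_complex_scale[OF \<beta>])
    then show ?thesis by (simp add: tr)
  qed
  show ?thesis
    unfolding eq[OF g] eq[OF h] by (subst sum.swap) (simp add: mult.commute)
qed

lemma trace_rank_one:
  assumes \<alpha>: "clinear \<alpha>"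
  shows "trace (\<lambda>w :: 'v. \<alpha> w *\<^sub>C u) = \<alpha> u"
proof -
  obtain T \<beta> where \<beta>: "\<And>b. clinear (\<beta> b)" and ex: "\<And>v. (\<Sum>b\<in>T. \<beta> b v *\<^sub>C b) = v"
    and tr: "\<And>h :: 'v \<Rightarrow> 'v. trace h = (\<Sum>b\<in>T. \<beta> b (h b))"
    using trace_basis by metis
  have "\<alpha> u = \<alpha> (\<Sum>b\<in>T. \<beta> b u *\<^sub>C b)" by (simp add: ex)
  also have "\<dots> = (\<Sum>b\<in>T. \<beta> b u * \<alpha> b)"
    by (simp only: clinear_sum[OF \<alpha>] clinear_complex_scale[OF \<alpha>])
  finally show ?thesis by (simp add: tr clinear_complex_scale[OF \<beta>] mult.commute)
qed

lemma trace_sum: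
  "trace (\<lambda>w :: 'v. \<Sum>a\<in>A. h a w) = (\<Sum>a\<in>A. trace (h a))"
proof -
  obtain T \<beta> where \<beta>: "\<And>b. clinear (\<beta> b)" and tr: "\<And>h :: 'v \<Rightarrow> 'v. trace h = (\<Sum>b\<in>T. \<beta> b (h b))"
    using trace_basis by metis
  show ?thesis by (simp add: tr clinear_sum[OF \<beta>]) (rule sum.swap)
qed

text \<open>Test against the rank-one maps sending \<open>w\<close> to
  \<open>\<beta> b w *\<^sub>C u\<close>: the resulting trace is the \<open>b\<close>-coordinate of
  \<open>h u\<close>.\<close>

lemma trace_nondegenerate:
  fixes h :: "'v \<Rightarrow> 'v"
  assumes h: "clinear h" and 0: "\<And>g. clinear g \<Longrightarrow> trace (h \<circ> g) = 0"
  shows "h = 0"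
proof
  fix u
  obtain T \<beta> where \<beta>: "\<And>b. clinear (\<beta> b)" and ex: "\<And>v :: 'v. (\<Sum>b\<in>T. \<beta> b v *\<^sub>C b) = v"
    using trace_basis by metis
  have "\<beta> b (h u) = 0" for b
  proof -
    have "h \<circ> (\<lambda>w. \<beta> b w *\<^sub>C u) = (\<lambda>w. \<beta> b w *\<^sub>C h u)" by (simp add: fun_eq_iff clinear_scale[OF h])
    then show ?thesis using 0[OF clinear_rank_one[OF \<beta>, of b u]] trace_rank_one[OF \<beta>] by simp
  qed
  then show "h u = 0 u" using ex[of "h u"] by simp
qed

text \<open>A linear \<open>h\<close> is the sum of the rank-one maps \<open>E b (h b)\<close>. The
  map \<open>Y\<close> has \<open>l (E b u)\<close> as the \<open>b\<close>-coordinate of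
  \<open>Y u\<close>, so the trace of \<open>Y \<circ> h\<close> collects exactly the values
  \<open>l (E b (h b))\<close>.\<close>

lemma trace_representation:
  fixes l :: "('v \<Rightarrow> 'v) \<Rightarrow> complex"
  assumes l: "clinear l"
  obtains Y :: "'v \<Rightarrow> 'v" where "clinear Y" "\<And>h. clinear h \<Longrightarrow> l h = trace (Y \<circ> h)"
proof -
  obtain T \<beta> where \<beta>: "\<And>b. clinear (\<beta> b)" and ex: "\<And>v :: 'v. (\<Sum>b\<in>T. \<beta> b v *\<^sub>C b) = v"
    using trace_basis by metis
  define E where "E b u = (\<lambda>w. \<beta> b w *\<^sub>C u)" for b and u :: 'v
  have E: "E b (u + u') = E b u + E b u'" "E b (a *\<^sub>C u) = a *\<^sub>C E b u" for b u u' a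
    by (simp_all add: E_def fun_eq_iff scaleC_add_right scaleC_fun_def scaleC_scaleC mult.commute)
  define Y where "Y u = (\<Sum>b\<in>T. l (E b u) *\<^sub>C b)" for u
  show thesis
  proof
    show Y: "clinear Y"
      by (simp add: clinear_iff Y_def E clinear_add[OF l] clinear_complex_scale[OF l] scaleC_add_left
          sum.distrib complex_vector.scale_sum_right scaleC_scaleC)
    fix h :: "'v \<Rightarrow> 'v" assume h: "clinear h"
    have hE: "h = (\<Sum>b\<in>T. E b (h b))"
    proof
      fix w
      have "h w = (\<Sum>b\<in>T. \<beta> b w *\<^sub>C h b)"
        by (subst ex[of w, symmetric]) (simp only: clinear_sum[OF h] clinear_scale[OF h])
      also have "\<dots> = (\<Sum>b\<in>T. E b (h b)) w"
        by (induction T rule: infinite_finite_induct) (simp_all add: E_def)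
      finally show "h w = (\<Sum>b\<in>T. E b (h b)) w" .
    qed
    have "Y \<circ> h = (\<lambda>w. \<Sum>b\<in>T. l (E b (h w)) *\<^sub>C b)" by (simp add: Y_def fun_eq_iff)
    then have "trace (Y \<circ> h) = (\<Sum>b\<in>T. trace (\<lambda>w. l (E b (h w)) *\<^sub>C b))" by (simp add: trace_sum)
    also have "\<dots> = (\<Sum>b\<in>T. l (E b (h b)))"
    proof (rule sum.cong[OF refl])
      fix b
      have "clinear (\<lambda>w. l (E b (h w)))"
        by (intro clinear_complexI)
           (simp_all add: E clinear_add[OF l] clinear_add[OF h] clinear_scale[OF h] clinear_complex_scale[OF l])
      then show "trace (\<lambda>w. l (E b (h w)) *\<^sub>C b) = l (E b (h b))" by (rule trace_rank_one)
    qed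
    also have "\<dots> = l h" by (subst (2) hE) (simp only: clinear_sum[OF l])
    finally show "l h = trace (Y \<circ> h)" ..
  qed
qed

section \<open>Commutators and adjoints under the trace\<close>

text \<open>This is the invariance of the trace form under ad. The term
  \<open>f \<circ> g \<circ> h\<close> is common to both sides, and the remaining terms agree by
  cyclicity.\<close>

lemma trace_commutator_shift:
  fixes f g h :: "'v \<Rightarrow> 'v"
  assumes "clinear f" "clinear g" "clinear h"
  shows "trace (f \<circ> commutator g h) = trace (commutator f g \<circ> h)"
proof -
  have "f \<circ> commutator g h = (f \<circ> g \<circ> h) - ((f \<circ> h) \<circ> g)"
    using assms by (simp add: commutator_def fun_eq_iff clinear_diff)
  moreover have "commutator f g \<circ> h = (f \<circ> g \<circ> h) - (g \<circ> (f \<circ> h))"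
    by (simp add: commutator_def fun_eq_iff)
  ultimately show ?thesis
    using assms trace_commute[of g "f \<circ> h"] by (simp add: trace_diff clinear_comp)
qed

text \<open>The image of \<open>ad f\<close> is the trace-orthogonal of the centralizer of \<open>f\<close>: a functional
  separating \<open>A\<close> from it would be \<open>h \<mapsto> trace (Y \<circ> h)\<close> with \<open>Y\<close> commuting with \<open>f\<close>.\<close>

lemma commutator_image:
  fixes f A :: "'v \<Rightarrow> 'v"
  assumes f: "clinear f" and A: "clinear A"
    and orth: "\<And>Y. clinear Y \<Longrightarrow> Y \<circ> f = f \<circ> Y \<Longrightarrow> trace (Y \<circ> A) = 0"
  obtains g where "clinear g" "commutator f g = A"
proof (rule ccontr)
  assume no: "\<not> thesis"
  define S where "S = commutator f ` {g. clinear g}"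
  have A_S: "A \<notin> S" using no that by (auto simp: S_def)
  have sub: "complex_vector.subspace S"
  proof (unfold complex_vector.subspace_def, intro conjI ballI allI)
    have "clinear (0 :: 'v \<Rightarrow> 'v)" by (simp add: clinear_iff)
    moreover have "0 = commutator f 0"
      by (simp add: commutator_def fun_eq_iff clinear_zero[OF f])
    ultimately show "0 \<in> S" unfolding S_def by blast
    fix x assume "x \<in> S"
    then obtain g where g: "clinear g" "x = commutator f g" by (auto simp: S_def)
    { fix y assume "y \<in> S"
      then obtain h where h: "clinear h" "y = commutator f h" by (auto simp: S_def)
      have "x + y = commutator f (g + h)"
        using f g h by (simp add: commutator_def fun_eq_iff clinear_add)
      then show "x + y \<in> S" using g h clinear_plus unfolding S_def by blast }
    fix c
    have "c *\<^sub>C x = commutator f (c *\<^sub>C g)"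
      using f g by (simp add: commutator_def fun_eq_iff clinear_scale scaleC_fun_def
          complex_vector.scale_right_diff_distrib)
    moreover have "clinear (c *\<^sub>C g)"
      using g by (simp add: clinear_iff scaleC_fun_def scaleC_add_right scaleC_scaleC mult.commute)
    ultimately show "c *\<^sub>C x \<in> S" unfolding S_def by blast
  qed
  obtain l :: "('v \<Rightarrow> 'v) \<Rightarrow> complex" where
    l: "clinear l" "\<And>x. x \<in> S \<Longrightarrow> l x = 0" "l A = 1"
    using subspace_separation[OF sub A_S] by blast
  obtain Y where Y: "clinear Y" "\<And>h. clinear h \<Longrightarrow> l h = trace (Y \<circ> h)"
    using trace_representation[OF l(1)] by blast
  \<comment> \<open>By invariance, the trace of \<open>commutator Y f \<circ> g\<close> is that of
    \<open>Y \<circ> commutator f g\<close>, which is \<open>l (commutator f g)\<close> and hence 0.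
    Nondegeneracy then applies.\<close>
  have "commutator Y f = 0"
  proof (rule trace_nondegenerate)
    show "clinear (commutator Y f)" by (simp add: clinear_commutator Y f)
    fix g :: "'v \<Rightarrow> 'v" assume g: "clinear g"
    have "trace (commutator Y f \<circ> g) = l (commutator f g)"
      using trace_commutator_shift[OF Y(1) f g] Y(2) f g by (simp add: clinear_commutator)
    then show "trace (commutator Y f \<circ> g) = 0" using l(2) g by (auto simp: S_def)
  qed
  then have "Y \<circ> f = f \<circ> Y" by (simp add: commutator_def)
  then have "l A = 0" using orth Y A by simp
  then show False using l(3) by simp
qed

text \<open>Here \<open>s = \<tau> \<circ> \<theta>\<^sup>-\<^sup>1\<close> and \<open>x = \<theta> \<circ> \<xi>\<close> are self-adjoint for the symmetric form induced by
  \<open>\<theta>\<close>, and \<open>k'\<close> is the adjoint of \<open>g'\<close>.\<close>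

lemma trace_self_adjoint_identity:
  fixes f s x s' x' g g' k' :: "'v \<Rightarrow> 'v"
  assumes lin: "clinear f" "clinear s" "clinear x" "clinear s'" "clinear x'"
      "clinear g" "clinear g'" "clinear k'"
    and g: "commutator f g = x + (s \<circ> f)" and g': "commutator f g' = x' + (s' \<circ> f)"
    and adj: "trace ((x + (s \<circ> f)) \<circ> g') = trace (k' \<circ> (x + (f \<circ> s)))"
    and sum0: "trace ((g' + k' + s') \<circ> (x + (f \<circ> s))) = 0"
  shows "trace (f \<circ> commutator g g') = 1 / 2 * (trace (s \<circ> x') - trace (s' \<circ> x))"
proof -
  define t where "t = trace (f \<circ> commutator g g')"
  have t: "t = trace (x \<circ> g') + trace (s \<circ> f \<circ> g')"
    unfolding t_def trace_commutator_shift[OF lin(1,6,7)] g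
    by (simp flip: trace_add) (simp add: o_def plus_fun_def)
  have "t = trace (k' \<circ> (x + (f \<circ> s)))"
    unfolding t_def trace_commutator_shift[OF lin(1,6,7)] g adj ..
  also have "\<dots> = - trace (g' \<circ> (x + (f \<circ> s))) - trace (s' \<circ> (x + (f \<circ> s)))"
  proof -
    have "(g' + k' + s') \<circ> (x + (f \<circ> s)) =
        (g' \<circ> (x + (f \<circ> s))) + (k' \<circ> (x + (f \<circ> s))) + (s' \<circ> (x + (f \<circ> s)))"
      by (simp add: fun_eq_iff)
    then show ?thesis using sum0 by (simp add: trace_add algebra_simps add_eq_0_iff)
  qed
  also have "trace (g' \<circ> (x + (f \<circ> s))) = trace (x \<circ> g') + trace (s \<circ> (g' \<circ> f))"
  proof -
    have "g' \<circ> (x + (f \<circ> s)) = (g' \<circ> x) + ((g' \<circ> f) \<circ> s)"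
      using lin by (simp add: fun_eq_iff clinear_add)
    then show ?thesis using lin trace_commute[of g' x] trace_commute[of "g' \<circ> f" s]
      by (simp add: trace_add clinear_comp)
  qed
  also have "trace (s' \<circ> (x + (f \<circ> s))) = trace (s' \<circ> x) + trace (s \<circ> (s' \<circ> f))"
  proof -
    have "s' \<circ> (x + (f \<circ> s)) = (s' \<circ> x) + ((s' \<circ> f) \<circ> s)"
      using lin by (simp add: fun_eq_iff clinear_add)
    then show ?thesis using lin trace_commute[of "s' \<circ> f" s]
      by (simp add: trace_add clinear_comp)
  qed
  finally have t': "t = - (trace (x \<circ> g') + trace (s \<circ> (g' \<circ> f))) -
      (trace (s' \<circ> x) + trace (s \<circ> (s' \<circ> f)))" .
  \<comment> \<open>Evaluating this trace once from the definition of the commutator and once from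
    \<open>g'\<close> relates the terms in \<open>s \<circ> f \<circ> g'\<close> and
    \<open>s \<circ> (g' \<circ> f)\<close>, the two that do not cancel directly when
    \<open>t\<close> and \<open>t'\<close> are added.\<close>
  have "trace (s \<circ> commutator f g') = trace (s \<circ> f \<circ> g') - trace (s \<circ> (g' \<circ> f))"
  proof -
    have "s \<circ> commutator f g' = (s \<circ> f \<circ> g') - (s \<circ> (g' \<circ> f))"
      using lin by (simp add: fun_eq_iff commutator_def clinear_diff)
    then show ?thesis by (simp add: trace_diff)
  qed
  moreover have "trace (s \<circ> commutator f g') = trace (s \<circ> x') + trace (s \<circ> (s' \<circ> f))"
  proof -
    have "s \<circ> commutator f g' = (s \<circ> x') + (s \<circ> (s' \<circ> f))"
      using lin by (simp add: fun_eq_iff g' clinear_add)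
    then show ?thesis by (simp add: trace_add)
  qed
  ultimately have eq: "trace (s \<circ> f \<circ> g') =
      trace (s \<circ> x') + trace (s \<circ> (s' \<circ> f)) + trace (s \<circ> (g' \<circ> f))"
    by (metis diff_add_cancel)
  \<comment> \<open>One copy of \<open>t\<close> is replaced by the direct expression, the other by
    the one obtained through the adjoint.\<close>
  have "2 * t = trace (s \<circ> x') - trace (s' \<circ> x)"
    unfolding mult_2 by (subst t, subst t', subst eq) simp
  then show ?thesis unfolding t_def by (simp add: mult.commute)
qed

text \<open>Let \<open>d b\<close> represent the coordinate functional \<open>\<beta> b\<close>
  through \<eta>, so that the \<open>d b\<close> form the dual basis. Adjointness writes
  \<open>Y\<close> as a sum of rank-one maps with traces \<open>\<eta> (X b) (d b)\<close>, and by
  symmetry these are the diagonal entries \<open>\<beta> b (X b)\<close> of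
  \<open>X\<close>.\<close>

lemma trace_adjoint:
  fixes X Y :: "'v \<Rightarrow> 'v" and \<eta> :: "'v \<Rightarrow> 'v \<Rightarrow> complex"
  assumes X: "clinear X"
    and lin: "\<And>u. clinear (\<eta> u)" and sym: "\<And>u w. \<eta> u w = \<eta> w u"
    and nondeg: "\<And>w w'. (\<And>u. \<eta> u w = \<eta> u w') \<Longrightarrow> w = w'"
    and repr: "\<And>\<alpha>. clinear \<alpha> \<Longrightarrow> \<exists>d. \<alpha> = \<eta> d"
    and adj: "\<And>u w. \<eta> (X u) w = \<eta> u (Y w)"
  shows "trace X = trace Y"
proof -
  obtain T \<beta> where \<beta>: "\<And>b. clinear (\<beta> b)" and ex: "\<And>v :: 'v. (\<Sum>b\<in>T. \<beta> b v *\<^sub>C b) = v"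
    and tr: "\<And>h :: 'v \<Rightarrow> 'v. trace h = (\<Sum>b\<in>T. \<beta> b (h b))"
    using trace_basis by metis
  obtain d where d: "\<And>b. \<beta> b = \<eta> (d b)" using repr[OF \<beta>] by metis
  have "Y w = (\<Sum>b\<in>T. \<eta> (X b) w *\<^sub>C d b)" for w
  proof (rule nondeg)
    fix u
    have "\<eta> u (Y w) = \<eta> w (X u)" by (simp add: adj sym[of w])
    also have "\<dots> = \<eta> w (X (\<Sum>b\<in>T. \<beta> b u *\<^sub>C b))" by (simp add: ex)
    also have "\<dots> = (\<Sum>b\<in>T. \<eta> (X b) w * \<eta> u (d b))"
      by (simp only: clinear_sum[OF X] clinear_sum[OF lin] clinear_scale[OF X]
          clinear_complex_scale[OF lin] d sym[of w] sym[of "d _" u] mult.commute)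
    also have "\<dots> = \<eta> u (\<Sum>b\<in>T. \<eta> (X b) w *\<^sub>C d b)"
      by (simp only: clinear_sum[OF lin] clinear_complex_scale[OF lin])
    finally show "\<eta> u (Y w) = \<eta> u (\<Sum>b\<in>T. \<eta> (X b) w *\<^sub>C d b)" .
  qed
  then have "trace Y = trace (\<lambda>w. \<Sum>b\<in>T. \<eta> (X b) w *\<^sub>C d b)" by presburger
  also have "\<dots> = (\<Sum>b\<in>T. \<eta> (X b) (d b))" by (simp add: trace_sum trace_rank_one[OF lin])
  also have "\<dots> = trace X" by (simp add: tr d sym[of "X _"])
  finally show ?thesis ..
qed

end

section \<open>Comparison of the two pairings\<close>

theorem proposition1p5:
  fixes B :: "'v::complex_vector set"
    and r :: nat
    and \<phi> :: "complex poly"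
    and f :: "'v \<Rightarrow> 'v"
    and \<theta> :: "'v dual \<Rightarrow> 'v"
    and \<kappa> :: "'v \<Rightarrow> 'v dual"
  assumes "finite_dimensional_vector_space (scaleC :: complex \<Rightarrow> 'v \<Rightarrow> 'v) B"
    and "complex_vector.dim (UNIV :: 'v set) = r"
    and "lead_coeff \<phi> = 1"
    and "degree \<phi> = r"
    and "f \<in> endos_with_minpoly \<phi>"
    and "\<theta> \<in> sym_from_dual" and "bij \<theta>"
    and "\<kappa> \<in> sym_to_dual"
    and "f = \<theta> \<circ> \<kappa>"
  shows "\<forall>X \<in> tangent_space f \<theta> \<kappa>. \<forall>X' \<in> tangent_space f \<theta> \<kappa>.
    omega_C X X' = omega_KK f \<theta> \<kappa> X X'"
proof -
  interpret finite_dim_complex B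
    using assms(1) by (simp add: finite_dim_complex_def)
  have f: "clinear f" and min: "is_minimal_poly f \<phi>"
    using assms(5) by (auto simp: endos_with_minpoly_def)
  have deg: "degree \<phi> = complex_vector.dim (UNIV :: 'v set)" using assms(2,4) by simp
  have \<theta>: "clinear \<theta>" using assms(6) by (simp add: sym_from_dual_def)
  have inv1: "inv \<theta> (\<theta> \<alpha>) = \<alpha>" for \<alpha> using assms(7) by (simp add: bij_is_inj)
  have inv2: "\<theta> (inv \<theta> v) = v" for v using assms(7) by (simp add: bij_is_surj surj_f_inv_f)
  have inv_lin: "clinear (inv \<theta>)"
  proof -
    have "inv \<theta> (u + v) = inv \<theta> u + inv \<theta> v" for u v
      using inv1[of "inv \<theta> u + inv \<theta> v"] by (simp add: clinear_add[OF \<theta>] inv2)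
    moreover have "inv \<theta> (a *\<^sub>C v) = a *\<^sub>C inv \<theta> v" for a v
      using inv1[of "a *\<^sub>C inv \<theta> v"] by (simp add: clinear_scale[OF \<theta>] inv2)
    ultimately show ?thesis by (simp add: clinear_iff)
  qed
  \<comment> \<open>Evaluating the equation between maps into the double dual turns it into symmetry
    of a bilinear form on the dual space.\<close>
  have sym_from: "dual_apply \<alpha> (\<tau> \<beta>) = dual_apply \<beta> (\<tau> \<alpha>)"
    if "\<tau> \<in> sym_from_dual" for \<tau> :: "'v dual \<Rightarrow> 'v" and \<alpha> \<beta>
    using that dual_apply_transpose_map[of \<tau> \<alpha> \<beta>]
    by (simp add: sym_from_dual_def eval_dual.rep_eq)
  have sym_to: "dual_apply (\<xi> v) w = dual_apply (\<xi> w) v"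
    if "\<xi> \<in> sym_to_dual" for \<xi> :: "'v \<Rightarrow> 'v dual" and v w
  proof -
    have "\<xi> v = transpose_map \<xi> (eval_dual v)" and l: "clinear \<xi>"
      using that by (auto simp: sym_to_dual_def fun_eq_iff)
    then show ?thesis
      using dual_apply_transpose_map[OF l, of "eval_dual v" w] by (simp add: eval_dual.rep_eq)
  qed
  have dual_lin: "clinear (dual_apply \<alpha>)" for \<alpha> :: "'v dual" using dual_apply[of \<alpha>] by simp
  define \<eta> where "\<eta> u w = dual_apply (inv \<theta> u) w" for u w
  have \<eta>_lin: "clinear (\<eta> u)" for u unfolding \<eta>_def by (simp add: dual_lin)
  have \<eta>_sym: "\<eta> u w = \<eta> w u" for u w
    unfolding \<eta>_def using sym_from[OF assms(6), of "inv \<theta> u" "inv \<theta> w"] by (simp add: inv2)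
  have \<eta>_repr: "\<exists>d. \<alpha> = \<eta> d" if "clinear \<alpha>" for \<alpha>
  proof
    show "\<alpha> = \<eta> (\<theta> (Abs_dual \<alpha>))"
      using that by (simp add: \<eta>_def inv1 Abs_dual_inverse fun_eq_iff)
  qed
  have \<eta>_nondeg: "w = w'" if "\<And>u. \<eta> u w = \<eta> u w'" for w w'
  proof -
    have "inv \<theta> w = inv \<theta> w'"
      using that by (subst dual_apply_inject[symmetric]) (simp add: fun_eq_iff \<eta>_sym flip: \<eta>_def)
    then show ?thesis by (metis inv2)
  qed
  \<comment> \<open>The inverse of \<theta> inside \<eta> cancels the \<theta>, leaving the bilinear
    form of \<xi>, which is symmetric.\<close>
  have sa_to: "\<eta> ((\<theta> \<circ> \<xi>) u) w = \<eta> u ((\<theta> \<circ> \<xi>) w)" if "\<xi> \<in> sym_to_dual" for \<xi> u w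
    by (subst (2) \<eta>_sym) (simp add: \<eta>_def inv1 sym_to[OF that])
  have sa_from: "\<eta> ((\<tau> \<circ> inv \<theta>) u) w = \<eta> u ((\<tau> \<circ> inv \<theta>) w)" if "\<tau> \<in> sym_from_dual" for \<tau> u w
    by (subst \<eta>_sym) (simp add: \<eta>_def sym_from[OF that])
  have sa_f: "\<eta> (f u) w = \<eta> u (f w)" for u w
    using sa_to[OF assms(8)] by (simp add: assms(9))
  define W where "W \<tau> \<xi> \<tau>' \<xi>' = 1 / 2 * trace ((\<tau> \<circ> \<xi>') - (\<tau>' \<circ> \<xi>))"
    for \<tau> \<tau>' :: "'v dual \<Rightarrow> 'v" and \<xi> \<xi>' :: "'v \<Rightarrow> 'v dual"
  \<comment> \<open>Since \<open>f = \<theta> \<circ> \<kappa>\<close>, the map \<kappa> equals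
    \<open>inv \<theta> \<circ> f\<close>.\<close>
  have A_eq: "(\<theta> \<circ> \<xi>) + (\<tau> \<circ> \<kappa>) = (\<theta> \<circ> \<xi>) + ((\<tau> \<circ> inv \<theta>) \<circ> f)" for \<tau> \<xi>
    by (simp add: fun_eq_iff assms(9) inv1)
  \<comment> \<open>Such a \<open>Y\<close> is \<open>poly_map P f\<close> for some
    \<open>P\<close>, and the trace is then the value of \<open>d1\<close> at
    \<open>P\<close>.\<close>
  have orth: "trace (Y \<circ> ((\<theta> \<circ> \<xi>) + (\<tau> \<circ> \<kappa>))) = 0"
    if "(\<tau>, \<xi>) \<in> d1_kernel f \<theta> \<kappa>" "clinear Y" "Y \<circ> f = f \<circ> Y" for \<tau> \<xi> Y
    using centralizer_poly_map[OF f min deg that(2,3)] that(1)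
    by (auto simp: d1_kernel_def d1_def dest: fun_cong)
  have main: "trace (f \<circ> commutator g g') = W \<tau> \<xi> \<tau>' \<xi>'"
    if ker: "(\<tau>, \<xi>) \<in> d1_kernel f \<theta> \<kappa>" "(\<tau>', \<xi>') \<in> d1_kernel f \<theta> \<kappa>"
      and g: "clinear g" "commutator f g = (\<theta> \<circ> \<xi>) + (\<tau> \<circ> \<kappa>)"
      and g': "clinear g'" "commutator f g' = (\<theta> \<circ> \<xi>') + (\<tau>' \<circ> \<kappa>)"
    for \<tau> \<xi> \<tau>' \<xi>' g g'
  proof -
    have S: "\<tau> \<in> sym_from_dual" "\<tau>' \<in> sym_from_dual" "\<xi> \<in> sym_to_dual" "\<xi>' \<in> sym_to_dual"
      using ker by (auto simp: d1_kernel_def)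
    define s x s' x' where sx: "s = \<tau> \<circ> inv \<theta>" "x = \<theta> \<circ> \<xi>" "s' = \<tau>' \<circ> inv \<theta>" "x' = \<theta> \<circ> \<xi>'"
    have lin: "clinear s" "clinear x" "clinear s'" "clinear x'"
      using S \<theta> inv_lin by (auto simp: sx sym_from_dual_def sym_to_dual_def intro!: clinear_comp)
    have sa: "\<eta> (s u) w = \<eta> u (s w)" "\<eta> (x u) w = \<eta> u (x w)"
      "\<eta> (s' u) w = \<eta> u (s' w)" "\<eta> (x' u) w = \<eta> u (x' w)" for u w
      unfolding sx using S sa_to sa_from by blast+
    have \<eta>_adds: "\<eta> u (a + b) = \<eta> u a + \<eta> u b" "\<eta> (a + b) u = \<eta> a u + \<eta> b u"
      "\<eta> u (a - b) = \<eta> u a - \<eta> u b" "\<eta> (a - b) u = \<eta> a u - \<eta> b u" for u a b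
      using \<eta>_lin[of u] \<eta>_sym[of _ u] by (simp_all add: clinear_add clinear_diff)
    define k' where "k' = \<theta> \<circ> transpose_map g' \<circ> inv \<theta>"
    have k'adj: "\<eta> (g' u) w = \<eta> u (k' w)" for u w
      by (subst (1 2) \<eta>_sym) (simp add: \<eta>_def k'_def inv1 dual_apply_transpose_map[OF g'(1)])
    \<comment> \<open>Linearity is tested by pairing with an arbitrary vector: \<eta> moves
      \<open>k'\<close> to \<open>g'\<close> in the other argument.\<close>
    have k'lin: "clinear k'"
      unfolding clinear_iff
      by (intro conjI allI; rule \<eta>_nondeg)
         (simp_all add: \<eta>_adds clinear_complex_scale[OF \<eta>_lin] flip: k'adj)
    have cg: "commutator f g = x + (s \<circ> f)" and cg': "commutator f g' = x' + (s' \<circ> f)"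
      unfolding sx by (simp_all add: g g' A_eq)
    have fg': "f (g' w) = g' (f w) + (x' w + s' (f w))" for w
      using cg' by (simp add: commutator_def fun_eq_iff algebra_simps)
    \<comment> \<open>Taking adjoints reverses the order of composition, fixes \<open>x\<close>,
      \<open>s\<close> and \<open>f\<close>, and turns \<open>g'\<close> into
      \<open>k'\<close>.\<close>
    have "trace ((x + (s \<circ> f)) \<circ> g') = trace (k' \<circ> (x + (f \<circ> s)))"
      by (rule trace_adjoint[OF _ \<eta>_lin \<eta>_sym \<eta>_nondeg \<eta>_repr])
         (use lin f g' in \<open>auto intro!: clinear_comp clinear_plus simp: \<eta>_adds sa sa_f simp flip: k'adj\<close>)
    moreover have "trace ((g' + k' + s') \<circ> (x + (f \<circ> s))) = 0"
    proof -
      define Y where "Y = g' + k' + s'"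
      have Ylin: "clinear Y" unfolding Y_def by (intro clinear_plus g' k'lin lin)
      \<comment> \<open>This is the adjoint of \<open>fg'\<close>. Adding the two relations, the
        \<open>x'\<close> terms cancel and \<open>s'\<close> accounts for the rest, so
        \<open>Y\<close> commutes with \<open>f\<close>.\<close>
      have kf: "k' (f w) = f (k' w) + (x' w + f (s' w))" for w
      proof (rule \<eta>_nondeg)
        fix u
        have "\<eta> u (k' (f w)) = \<eta> (f (g' u)) w" by (simp add: sa_f k'adj)
        also have "\<dots> = \<eta> u (f (k' w) + (x' w + f (s' w)))"
          by (simp only: fg') (simp add: \<eta>_adds sa sa_f k'adj)
        finally show "\<eta> u (k' (f w)) = \<eta> u (f (k' w) + (x' w + f (s' w)))" .
      qed
      have Yf: "Y \<circ> f = f \<circ> Y"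
        using f by (simp add: fun_eq_iff Y_def clinear_add kf fg' algebra_simps)
      have "trace (Y \<circ> (x + (s \<circ> f))) = 0"
        using orth[OF ker(1) Ylin Yf] by (simp add: sx A_eq)
      \<comment> \<open>The orthogonality concerns \<open>x + (s \<circ> f)\<close>, while the goal
        has \<open>f \<circ> s\<close>. Commuting \<open>f\<close> past \<open>Y\<close> and using
        cyclicity exchanges them.\<close>
      moreover have "trace (Y \<circ> (f \<circ> s)) = trace (Y \<circ> (s \<circ> f))"
        using trace_commute[OF f clinear_comp[OF Ylin lin(1)]] Yf by (metis comp_assoc)
      moreover have "Y \<circ> (a + b) = (Y \<circ> a) + (Y \<circ> b)" for a b :: "'v \<Rightarrow> 'v"
        by (simp add: fun_eq_iff clinear_add[OF Ylin])
      ultimately show ?thesis unfolding Y_def[symmetric] by (simp add: trace_add)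
    qed
    ultimately have "trace (f \<circ> commutator g g') = 1 / 2 * (trace (s \<circ> x') - trace (s' \<circ> x))"
      using trace_self_adjoint_identity[OF f lin g(1) g'(1) k'lin cg cg'] by blast
    moreover have "s \<circ> x' = \<tau> \<circ> \<xi>'" by (simp add: sx fun_eq_iff inv1)
    moreover have "s' \<circ> x = \<tau>' \<circ> \<xi>" by (simp add: sx fun_eq_iff inv1)
    ultimately show ?thesis by (simp only: W_def trace_diff)
  qed
  have preimage: "\<exists>g. clinear g \<and> commutator f g = (\<theta> \<circ> \<xi>) + (\<tau> \<circ> \<kappa>)"
    if "(\<tau>, \<xi>) \<in> d1_kernel f \<theta> \<kappa>" for \<tau> \<xi>
  proof -
    have "clinear ((\<theta> \<circ> \<xi>) + (\<tau> \<circ> \<kappa>))"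
      using that \<theta> assms(8)
      by (auto simp: d1_kernel_def sym_from_dual_def sym_to_dual_def intro!: clinear_plus clinear_comp)
    from commutator_image[OF f this orth[OF that]] show ?thesis by blast
  qed
  have tangent: "\<exists>\<tau>\<^sub>0 \<xi>\<^sub>0. (\<tau>\<^sub>0, \<xi>\<^sub>0) \<in> X \<and> (\<forall>(\<tau>, \<xi>) \<in> X. (\<tau>, \<xi>) \<in> d1_kernel f \<theta> \<kappa> \<and>
      (\<theta> \<circ> \<xi>) + (\<tau> \<circ> \<kappa>) = (\<theta> \<circ> \<xi>\<^sub>0) + (\<tau>\<^sub>0 \<circ> \<kappa>))" if XT: "X \<in> tangent_space f \<theta> \<kappa>" for X
  proof -
    obtain x\<^sub>0 where x0: "x\<^sub>0 \<in> d1_kernel f \<theta> \<kappa>"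
      "X = {y \<in> d1_kernel f \<theta> \<kappa>. x\<^sub>0 - y \<in> range (d0 f \<theta> \<kappa>)}"
      using XT unfolding tangent_space_def by (elim quotientE) blast
    obtain \<tau>\<^sub>0 \<xi>\<^sub>0 where "x\<^sub>0 = (\<tau>\<^sub>0, \<xi>\<^sub>0)" by (cases x\<^sub>0)
    note X = x0[unfolded this]
    \<comment> \<open>This puts the representative into its own class, so the class is
      nonempty.\<close>
    have zero: "0 = d0 f \<theta> \<kappa> 0"
      using \<theta> by (simp add: d0_def fun_eq_iff clinear_zero zero_prod_def)
    \<comment> \<open>An element of the image of \<open>d0\<close> contributes \<open>\<theta>
      \<circ> poly_map P (transpose_map f) \<circ> \<kappa>\<close> once with each sign.\<close>
    have "(\<theta> \<circ> \<xi>) + (\<tau> \<circ> \<kappa>) = (\<theta> \<circ> \<xi>\<^sub>0) + (\<tau>\<^sub>0 \<circ> \<kappa>)" if \<tau>\<xi>: "(\<tau>, \<xi>) \<in> X" for \<tau> \<xi>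
    proof -
      obtain P where "(\<tau>\<^sub>0, \<xi>\<^sub>0) - (\<tau>, \<xi>) = d0 f \<theta> \<kappa> P" using \<tau>\<xi> X by blast
      then have "\<tau>\<^sub>0 v = \<tau> v + \<theta> (poly_map P (transpose_map f) v)"
        "\<xi>\<^sub>0 w = \<xi> w - poly_map P (transpose_map f) (\<kappa> w)" for v w
        by (auto simp: d0_def fun_eq_iff algebra_simps)
      then show ?thesis using \<theta> by (simp add: fun_eq_iff clinear_diff)
    qed
    moreover have "(\<tau>\<^sub>0, \<xi>\<^sub>0) \<in> X" using X zero by auto
    ultimately show ?thesis using X by blast
  qed
  show ?thesis
  proof (intro ballI)
    fix X X' assume X: "X \<in> tangent_space f \<theta> \<kappa>" and X': "X' \<in> tangent_space f \<theta> \<kappa>"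
    obtain \<tau>\<^sub>0 \<xi>\<^sub>0 where X0: "(\<tau>\<^sub>0, \<xi>\<^sub>0) \<in> X"
      and XD: "\<And>\<tau> \<xi>. (\<tau>, \<xi>) \<in> X \<Longrightarrow> (\<tau>, \<xi>) \<in> d1_kernel f \<theta> \<kappa> \<and>
        (\<theta> \<circ> \<xi>) + (\<tau> \<circ> \<kappa>) = (\<theta> \<circ> \<xi>\<^sub>0) + (\<tau>\<^sub>0 \<circ> \<kappa>)"
      using tangent[OF X] by fast
    obtain \<tau>\<^sub>1 \<xi>\<^sub>1 where X1: "(\<tau>\<^sub>1, \<xi>\<^sub>1) \<in> X'"
      and XD': "\<And>\<tau> \<xi>. (\<tau>, \<xi>) \<in> X' \<Longrightarrow> (\<tau>, \<xi>) \<in> d1_kernel f \<theta> \<kappa> \<and>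
        (\<theta> \<circ> \<xi>) + (\<tau> \<circ> \<kappa>) = (\<theta> \<circ> \<xi>\<^sub>1) + (\<tau>\<^sub>1 \<circ> \<kappa>)"
      using tangent[OF X'] by fast
    obtain g where g: "clinear g" "commutator f g = (\<theta> \<circ> \<xi>\<^sub>0) + (\<tau>\<^sub>0 \<circ> \<kappa>)"
      using preimage XD[OF X0] by blast
    obtain g' where g': "clinear g'" "commutator f g' = (\<theta> \<circ> \<xi>\<^sub>1) + (\<tau>\<^sub>1 \<circ> \<kappa>)"
      using preimage XD'[OF X1] by blast
    define z where "z = trace (f \<circ> commutator g g')"
    \<comment> \<open>All representatives of a class give the same tangent vector, so the fixed
      \<open>g\<close> and \<open>g'\<close> serve for every pair of them, and \<open>main\<close>
      forces one common value.\<close>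
    have Wz: "W \<tau> \<xi> \<tau>' \<xi>' = z" if "(\<tau>, \<xi>) \<in> X" "(\<tau>', \<xi>') \<in> X'" for \<tau> \<xi> \<tau>' \<xi>'
      unfolding z_def using main[of \<tau> \<xi> \<tau>' \<xi>' g g'] XD[OF that(1)] XD'[OF that(2)] g g' by simp
    have "omega_C X X' = z"
      unfolding omega_C_def
    proof (rule the_equality)
      show "\<exists>(\<tau>, \<xi>)\<in>X. \<exists>(\<tau>', \<xi>')\<in>X'. z = 1/2 * trace ((\<tau> \<circ> \<xi>') - (\<tau>' \<circ> \<xi>))"
        using Wz[OF X0 X1] X0 X1 unfolding W_def by blast
      fix y assume "\<exists>(\<tau>, \<xi>)\<in>X. \<exists>(\<tau>', \<xi>')\<in>X'. y = 1/2 * trace ((\<tau> \<circ> \<xi>') - (\<tau>' \<circ> \<xi>))"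
      then show "y = z" using Wz unfolding W_def by blast
    qed
    moreover have "omega_KK f \<theta> \<kappa> X X' = z"
      unfolding omega_KK_def
    proof (rule the_equality)
      show "\<exists>(\<tau>, \<xi>)\<in>X. \<exists>(\<tau>', \<xi>')\<in>X'. \<exists>g g'. clinear g \<and> clinear g' \<and>
        commutator f g = (\<theta> \<circ> \<xi>) + (\<tau> \<circ> \<kappa>) \<and> commutator f g' = (\<theta> \<circ> \<xi>') + (\<tau>' \<circ> \<kappa>) \<and>
        z = trace (f \<circ> commutator g g')"
        using X0 X1 g g' z_def by blast
      fix y assume "\<exists>(\<tau>, \<xi>)\<in>X. \<exists>(\<tau>', \<xi>')\<in>X'. \<exists>g g'. clinear g \<and> clinear g' \<and>
        commutator f g = (\<theta> \<circ> \<xi>) + (\<tau> \<circ> \<kappa>) \<and> commutator f g' = (\<theta> \<circ> \<xi>') + (\<tau>' \<circ> \<kappa>) \<and>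
        y = trace (f \<circ> commutator g g')"
      then obtain \<tau> \<xi> \<tau>' \<xi>' h h' where r: "(\<tau>, \<xi>) \<in> X" "(\<tau>', \<xi>') \<in> X'" "clinear h" "clinear h'"
        "commutator f h = (\<theta> \<circ> \<xi>) + (\<tau> \<circ> \<kappa>)" "commutator f h' = (\<theta> \<circ> \<xi>') + (\<tau>' \<circ> \<kappa>)"
        "y = trace (f \<circ> commutator h h')" by blast
      \<comment> \<open>\<open>main\<close> holds for any preimages \<open>h\<close> and
        \<open>h'\<close>, so their choice does not affect the value.\<close>
      then show "y = z" using main[of \<tau> \<xi> \<tau>' \<xi>' h h'] XD XD' Wz by simp
    qed
    ultimately show "omega_C X X' = omega_KK f \<theta> \<kappa> X X'" by simp
  qed
qed

end
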